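(* For every prime power $q$, there are infinitely many pairs $(F,G)$ of nonzero polynomials in $\mathbb{F}_q[T]$ with $\varphi(F)=\sigma_{nm}(G)$.
   Context: For a nonzero $A\in\mathbb{F}_q[T]$ let $|A|=q^{\deg A}$. For nonzero $F$, $\varphi(F)=\#(\mathbb{F}_q[T]/(F))^*=\prod_{P\mid F}|P|^{v_P(F)-1}(|P|-1)$, the product over monic irreducible $P$ dividing $F$ with $v_P(F)$ the exponent of $P$ in $F$. For nonzero $G$, $\sigma_{nm}(G)=\sum_{D\mid G}|D|$, where the sum runs over all (not necessarily monic) divisors $D$ of $G$ in $\mathbb{F}_q[T]$. *)

theory Defs
  imports "HOL-Algebra.Algebraic_Closure_Type" "HOL-Computational_Algebra.Polynomial"
    "HOL-Library.Cardinality"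
begin

text \<open>
  The field with \<open>q\<close> elements is a type \<open>'a\<close> of sort \<open>{field,finite}\<close>, with \<open>q = CARD('a)\<close>.
  Only meant for nonzero polynomials: \<open>poly_abs 0 = 1\<close>.
\<close>
definition poly_abs :: "'a::{field,finite} poly \<Rightarrow> nat"
  where "poly_abs A = CARD('a) ^ Polynomial.degree A"

definition poly_phi :: "'a::{field,finite} poly \<Rightarrow> nat"
  where "poly_phi F =
    card (Units ((ring_of_type_algebra :: 'a poly ring) Quot (PIdl\<^bsub>ring_of_type_algebra\<^esub> F)))"

definition poly_sigma_nm :: "'a::{field,finite} poly \<Rightarrow> nat"
  where "poly_sigma_nm G = (\<Sum>D | D dvd G. poly_abs D)"

text \<open>For \<open>G \<noteq> 0\<close> the sum above is over a finite set, so it is the true divisor sum.\<close>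
lemma finite_poly_divisors:
  fixes G :: "'a::{field,finite} poly"
  assumes "G \<noteq> 0"
  shows "finite {D. D dvd G}"
proof (rule finite_subset)
  show "{D. D dvd G} \<subseteq> Poly ` {xs. set xs \<subseteq> UNIV \<and> length xs \<le> Suc (Polynomial.degree G)}"
  proof
    fix D assume "D \<in> {D. D dvd G}"
    then have "Polynomial.degree D \<le> Polynomial.degree G"
      using assms by (auto intro: dvd_imp_degree_le)
    then have "length (coeffs D) \<le> Suc (Polynomial.degree G)"
      by (cases "D = 0") (auto simp: length_coeffs_degree)
    then show "D \<in> Poly ` {xs. set xs \<subseteq> UNIV \<and> length xs \<le> Suc (Polynomial.degree G)}"
      by (intro image_eqI[of _ _ "coeffs D"]) auto
  qed
  show "finite (Poly ` {xs :: 'a list. set xs \<subseteq> UNIV \<and> length xs \<le> Suc (Polynomial.degree G)})"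
    by (intro finite_imageI finite_lists_length_le) simp
qed

text \<open>Likewise \<open>poly_phi F\<close> is a true cardinality for \<open>F \<noteq> 0\<close>.\<close>
lemma finite_Units_poly_Quot:
  fixes F :: "'a::{field,finite} poly"
  assumes "F \<noteq> 0"
  shows "finite (Units ((ring_of_type_algebra :: 'a poly ring) Quot (PIdl\<^bsub>ring_of_type_algebra\<^esub> F)))"
proof -
  define R where "R = (ring_of_type_algebra :: 'a poly ring)"
  have cl: "PIdl\<^bsub>R\<^esub> F +>\<^bsub>R\<^esub> A = {B. F dvd B - A}" for A
  proof -
    have 1: "B \<in> PIdl\<^bsub>R\<^esub> F +>\<^bsub>R\<^esub> A \<longleftrightarrow> (\<exists>x. B = x * F + A)" for B
      by (auto simp: R_def ring_of_type_algebra_def cgenideal_def a_r_coset_def r_coset_def)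
    have 2: "(\<exists>x. B = x * F + A) \<longleftrightarrow> F dvd B - A" for B
      by (auto simp: dvd_def algebra_simps)
    show ?thesis using 1 2 by blast
  qed
  have carr: "carrier R = UNIV"
    by (simp add: R_def ring_of_type_algebra_def)
  have "carrier (R Quot (PIdl\<^bsub>R\<^esub> F)) = (\<Union>A\<in>carrier R. {PIdl\<^bsub>R\<^esub> F +>\<^bsub>R\<^esub> A})"
    by (simp add: FactRing_def A_RCOSETS_def RCOSETS_def a_r_coset_def)
  also have "\<dots> = range (\<lambda>A. {B. F dvd B - A})"
    unfolding cl carr by blast
  also have "\<dots> \<subseteq> (\<lambda>xs. {B. F dvd B - Poly xs}) `
      {xs. set xs \<subseteq> UNIV \<and> length xs \<le> Suc (Polynomial.degree F)}"
  proof safe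
    fix A :: "'a poly"
    have "Polynomial.degree (A mod F) \<le> Polynomial.degree F"
      using degree_mod_less'[OF assms, of A] by (cases "A mod F = 0") auto
    then have "length (coeffs (A mod F)) \<le> Suc (Polynomial.degree F)"
      by (cases "A mod F = 0") (auto simp: length_coeffs_degree)
    moreover have "{B. F dvd B - A} = {B. F dvd B - Poly (coeffs (A mod F))}"
      by (simp flip: mod_eq_dvd_iff)
    ultimately show "{B. F dvd B - A} \<in> (\<lambda>xs. {B. F dvd B - Poly xs}) `
      {xs. set xs \<subseteq> UNIV \<and> length xs \<le> Suc (Polynomial.degree F)}"
      by (intro image_eqI[of _ _ "coeffs (A mod F)"]) auto
  qed
  finally have "finite (carrier (R Quot (PIdl\<^bsub>R\<^esub> F)))"
    by (rule finite_subset) (intro finite_imageI finite_lists_length_le, simp)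
  then show ?thesis
    unfolding R_def by (rule finite_subset[rotated]) (auto simp: Units_def)
qed

end

theory Submission
  imports Defs "HOL-Computational_Algebra.Polynomial_Factorial"
begin

text \<open>
  If \<open>F\<close> is irreducible of degree \<open>k + 1\<close>, then the residue ring modulo \<open>F\<close> is a field, so
  \<open>\<phi>(F) = q\<^sup>k\<^sup>+\<^sup>1 - 1\<close>. The divisors of \<open>T\<^sup>k\<close> are the \<open>c T\<^sup>i\<close> with \<open>c \<noteq> 0\<close> and \<open>i \<le> k\<close>, so
  \<open>\<sigma>\<^sub>n\<^sub>m(T\<^sup>k) = (q - 1)(1 + q + \<dots> + q\<^sup>k) = q\<^sup>k\<^sup>+\<^sup>1 - 1\<close> as well. Euclid's argument yields
  irreducible polynomials of arbitrarily large degree.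
\<close>

section \<open>Counting polynomials of bounded degree\<close>

text \<open>Splitting off the constant coefficient sets up the count by induction on
  \<open>n\<close>. The disjunct \<open>A = 0\<close> matters because the zero polynomial has degree
  0 here: for \<open>n = 0\<close> the set contains just 0 and has size q^0.\<close>

lemma poly_degree_less_Suc:
  "{A :: 'a::zero poly. A = 0 \<or> Polynomial.degree A < Suc n} =
     (\<lambda>(c, A). pCons c A) ` (UNIV \<times> {A. A = 0 \<or> Polynomial.degree A < n})"
proof (intro equalityI subsetI)
  fix A :: "'a poly"
  assume A: "A \<in> {A. A = 0 \<or> Polynomial.degree A < Suc n}"
  obtain c B where "A = pCons c B"
    by (cases A)
  with A show "A \<in> (\<lambda>(c, A). pCons c A) ` (UNIV \<times> {A. A = 0 \<or> Polynomial.degree A < n})"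
    by (intro image_eqI[of _ _ "(c, B)"]) (auto split: if_splits)
qed (auto simp: degree_pCons_eq_if split: if_splits)

lemma card_poly_degree_less:
  "finite {A :: 'a::{zero,finite} poly. A = 0 \<or> Polynomial.degree A < n} \<and>
   card {A :: 'a poly. A = 0 \<or> Polynomial.degree A < n} = CARD('a) ^ n"
proof (induction n)
  case 0
  show ?case by simp
next
  case (Suc n)
  have "inj_on (\<lambda>(c, A). pCons c A)
      (UNIV \<times> {A :: 'a poly. A = 0 \<or> Polynomial.degree A < n})"
    by (auto simp: inj_on_def)
  with Suc show ?case
    by (simp add: poly_degree_less_Suc card_image card_cartesian_product)
qed

section \<open>Divisors of powers of T\<close>

text \<open>By induction on \<open>k\<close>: if D * E = T^(k+1), the constant coefficients of D and
  E multiply to 0, so T divides one of the two factors and can be cancelled.\<close>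

lemma dvd_monom_one_iff:
  fixes D :: "'a::field poly"
  shows "D dvd monom 1 k \<longleftrightarrow> (\<exists>c i. c \<noteq> 0 \<and> i \<le> k \<and> D = monom c i)"
proof
  assume "D dvd monom 1 k"
  then show "\<exists>c i. c \<noteq> 0 \<and> i \<le> k \<and> D = monom c i"
  proof (induction k arbitrary: D)
    case 0
    then have "is_unit D" by (simp add: Polynomial.monom_0 one_pCons)
    then obtain c where c: "D = [:c:]" by (auto simp: is_unit_poly_iff)
    with 0 have "c \<noteq> 0" by auto
    with c show ?case by (auto simp: Polynomial.monom_0)
  next
    case (Suc k)
    from Suc.prems obtain E where E: "monom 1 (Suc k) = D * E" by (rule dvdE)
    obtain d D' where D: "D = pCons d D'" by (rule pCons_cases)
    obtain e E' where E': "E = pCons e E'" by (rule pCons_cases)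
    have "d * e = 0"
      using arg_cong[OF E, of "\<lambda>p. coeff p 0"] D E' by (auto simp: coeff_mult)
    then consider "d = 0" | "e = 0" by auto
    then show ?case
    proof cases
      case 1
      with E D have "monom 1 k = D' * E" by (simp add: monom_Suc)
      then have "D' dvd monom 1 k" by simp
      from Suc.IH[OF this] obtain c i where "c \<noteq> 0" "i \<le> k" "D' = monom c i" by blast
      with D 1 show ?thesis
        by (intro exI[of _ c] exI[of _ "Suc i"]) (simp add: monom_Suc)
    next
      case 2
      with E E' have "monom 1 k = D * E'" by (simp add: monom_Suc)
      then have "D dvd monom 1 k" by simp
      from Suc.IH[OF this] show ?thesis using le_SucI by blast
    qed
  qed
next
  assume "\<exists>c i. c \<noteq> 0 \<and> i \<le> k \<and> D = monom c i"
  then obtain c i where "c \<noteq> 0" "i \<le> k" "D = monom c i" by blast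
  then have "monom 1 k = D * monom (inverse c) (k - i)"
    by (simp add: mult_monom)
  then show "D dvd monom 1 k" by simp
qed

lemma poly_sigma_nm_monom:
  "poly_sigma_nm (monom 1 k :: 'a::{field,finite} poly) = CARD('a) ^ Suc k - 1"
proof -
  let ?f = "\<lambda>(c, i). monom c i :: 'a poly"
  have "{D :: 'a poly. D dvd monom 1 k} = ?f ` ((UNIV - {0}) \<times> {..k})"
    by (auto simp: dvd_monom_one_iff)
  moreover have "inj_on ?f ((UNIV - {0}) \<times> {..k})"
    by (auto simp: inj_on_def monom_eq_iff')
  ultimately have "poly_sigma_nm (monom 1 k :: 'a poly) =
      (\<Sum>(c, i)\<in>(UNIV - {0 :: 'a}) \<times> {..k}. poly_abs (monom c i))"
    by (simp add: poly_sigma_nm_def sum.reindex case_prod_unfold)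
  \<comment> \<open>The index set supplies \<open>c \<noteq> 0\<close>, without which
    \<open>monom c i\<close> would not have degree \<open>i\<close>.\<close>
  also have "\<dots> = (\<Sum>(c, i)\<in>(UNIV - {0 :: 'a}) \<times> {..k}. CARD('a) ^ i)"
    by (intro sum.cong refl, simp only: split_beta mem_Times_iff)
      (simp add: poly_abs_def Polynomial.degree_monom_eq)
  also have "\<dots> = (CARD('a) - 1) * (\<Sum>i\<le>k. CARD('a) ^ i)"
    by (simp add: sum.cartesian_product[symmetric] card_Diff_singleton)
  also have "\<dots> = CARD('a) ^ Suc k - 1"
  proof -
    \<comment> \<open>Writing q = m + 1 puts the geometric sum in additive form, free of truncated
      subtraction.\<close>
    obtain m where m: "CARD('a) = Suc m"
      by (metis Suc_pred zero_less_card_finite)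
    have "Suc (m * (\<Sum>i\<le>k. Suc m ^ i)) = Suc m ^ Suc k"
      by (induction k) (simp_all add: algebra_simps)
    then show ?thesis unfolding m by (metis diff_Suc_1)
  qed
  finally show ?thesis .
qed

section \<open>The totient of an irreducible polynomial\<close>

text \<open>Since F is prime, multiplication by A is injective on the finite set of remainders
  modulo F. It is therefore surjective and hits 1.\<close>

lemma exists_inverse_mod_irreducible:
  fixes F A :: "'a::{field,finite} poly"
  assumes F: "Factorial_Ring.irreducible F" and A: "\<not> F dvd A"
  shows "\<exists>B. F dvd A * B - 1"
proof -
  have prime: "prime_elem F"
    using F by (rule field_poly_irreducible_imp_prime)
  have F0: "F \<noteq> 0" using F by auto
  have nu: "\<not> is_unit F" using F by (auto simp: Factorial_Ring.irreducible_def)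
  then have deg: "Polynomial.degree F > 0"
    using F0 is_unit_iff_degree by blast
  let ?S = "{B :: 'a poly. B = 0 \<or> Polynomial.degree B < Polynomial.degree F}"
  have "inj_on (\<lambda>B. (A * B) mod F) ?S"
  proof (rule inj_onI)
    fix B C assume BC: "B \<in> ?S" "C \<in> ?S" and "(A * B) mod F = (A * C) mod F"
    then have "F dvd A * (B - C)"
      by (simp add: mod_eq_dvd_iff algebra_simps)
    then have "F dvd B - C"
      using prime A by (auto simp: prime_elem_dvd_mult_iff)
    \<comment> \<open>\<open>deg\<close> covers the case of a zero remainder, whose degree is
      0.\<close>
    moreover have "Polynomial.degree (B - C) < Polynomial.degree F"
      using BC deg by (auto intro: degree_diff_less)
    ultimately show "B = C"
      using dvd_imp_degree_le[of F "B - C"] by (cases "B = C") auto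
  qed
  moreover have "(\<lambda>B. (A * B) mod F) ` ?S \<subseteq> ?S"
    using degree_mod_less[OF F0] by auto
  ultimately have "(\<lambda>B. (A * B) mod F) ` ?S = ?S"
    using card_poly_degree_less[where 'a = 'a, of "Polynomial.degree F"]
    by (intro endo_inj_surj) auto
  moreover have "1 \<in> ?S" using deg by simp
  ultimately obtain B where "1 = (A * B) mod F" by blast
  then have "(A * B) mod F = 1 mod F" by (metis mod_mod_trivial)
  then have "F dvd A * B - 1" by (simp only: mod_eq_dvd_iff)
  then show ?thesis ..
qed

text \<open>The units are the classes of the nonzero remainders modulo F, and distinct remainders
  give distinct classes.\<close>

lemma poly_phi_irreducible:
  fixes F :: "'a::{field,finite} poly"
  assumes F: "Factorial_Ring.irreducible F"
  shows "poly_phi F = CARD('a) ^ Polynomial.degree F - 1"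
proof -
  define R where "R = (ring_of_type_algebra :: 'a poly ring)"
  \<comment> \<open>An explicit form of the cosets of the principal ideal, which turns statements
    about the quotient ring into divisibility by F.\<close>
  define cl where "cl = (\<lambda>A. {B. F dvd B - A})"
  let ?I = "PIdl\<^bsub>R\<^esub> F"
  let ?S = "{B :: 'a poly. B = 0 \<or> Polynomial.degree B < Polynomial.degree F}"
  have F0: "F \<noteq> 0" using F by auto
  have nu: "\<not> is_unit F" using F by (auto simp: Factorial_Ring.irreducible_def)
  then have deg: "Polynomial.degree F > 0"
    using F0 is_unit_iff_degree by blast
  interpret cring R unfolding R_def by (rule cring_from_type_algebra)
  have carr: "carrier R = UNIV" by (simp add: R_def ring_of_type_algebra_def)
  interpret I: ideal ?I R by (rule cgenideal_ideal) (simp add: carr)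
  have coset: "?I +>\<^bsub>R\<^esub> A = cl A" for A
  proof -
    have "B \<in> ?I +>\<^bsub>R\<^esub> A \<longleftrightarrow> (\<exists>x. B = x * F + A)" for B
      by (auto simp: R_def ring_of_type_algebra_def cgenideal_def a_r_coset_def r_coset_def)
    moreover have "(\<exists>x. B = x * F + A) \<longleftrightarrow> F dvd B - A" for B
      by (auto simp: dvd_def algebra_simps)
    ultimately show ?thesis unfolding cl_def by blast
  qed
  have cl_eq: "cl A = cl B \<longleftrightarrow> F dvd A - B" for A B
    unfolding cl_def by (auto simp flip: mod_eq_dvd_iff)
  have carrQ: "carrier (R Quot ?I) = range cl"
    unfolding FactRing_def A_RCOSETS_def' coset carr by auto
  have multQ: "cl A \<otimes>\<^bsub>R Quot ?I\<^esub> cl B = cl (A * B)" for A B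
  proof -
    have "[mod ?I:] (?I +>\<^bsub>R\<^esub> A) \<Otimes>\<^bsub>R\<^esub> (?I +>\<^bsub>R\<^esub> B) = ?I +>\<^bsub>R\<^esub> (A \<otimes>\<^bsub>R\<^esub> B)"
      by (rule I.rcoset_mult_add) (simp_all add: carr)
    then show ?thesis
      by (simp add: coset FactRing_def) (simp add: R_def ring_of_type_algebra_def)
  qed
  have oneQ: "\<one>\<^bsub>R Quot ?I\<^esub> = cl 1"
    by (simp add: FactRing_def coset) (simp add: R_def ring_of_type_algebra_def)
  have unit_iff: "cl A \<in> Units (R Quot ?I) \<longleftrightarrow> \<not> F dvd A" for A
  proof -
    have "cl A \<in> Units (R Quot ?I) \<longleftrightarrow> (\<exists>B. F dvd A * B - 1)"
      unfolding Units_def carrQ by (auto simp: multQ oneQ cl_eq mult.commute)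
    also have "\<dots> \<longleftrightarrow> \<not> F dvd A"
    proof
      assume "\<exists>B. F dvd A * B - 1"
      then obtain B where B: "F dvd A * B - 1" ..
      show "\<not> F dvd A"
      proof
        assume "F dvd A"
        then have "F dvd A * B" by (rule dvd_mult2)
        then have "F dvd A * B - (A * B - 1)" using B by (rule dvd_diff)
        also have "A * B - (A * B - 1) = 1" by (rule diff_diff_eq2[THEN trans]) simp
        finally have "is_unit F" .
        with nu show False ..
      qed
    qed (rule exists_inverse_mod_irreducible[OF F])
    finally show ?thesis .
  qed
  \<comment> \<open>Serves twice below: nonzero remainders give units, and congruent remainders are
    equal.\<close>
  have small: "F dvd A \<longleftrightarrow> A = 0" if "A \<in> ?S" for A
    using that dvd_imp_degree_le[of F A] by (cases "A = 0") auto
  have "Units (R Quot ?I) = cl ` (?S - {0})"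
  proof (intro equalityI subsetI)
    fix x assume x: "x \<in> Units (R Quot ?I)"
    then obtain A where A: "x = cl A" unfolding Units_def carrQ by auto
    have "x = cl (A mod F)"
      unfolding A cl_eq by (simp flip: mod_eq_dvd_iff)
    moreover have "A mod F \<in> ?S - {0}"
      using x unit_iff[of A] A degree_mod_less[OF F0, of A] by auto
    ultimately show "x \<in> cl ` (?S - {0})" by (rule image_eqI)
  next
    fix x assume "x \<in> cl ` (?S - {0})"
    then show "x \<in> Units (R Quot ?I)" using unit_iff small by auto
  qed
  moreover have "inj_on cl (?S - {0})"
  proof (rule inj_onI)
    fix A B assume "A \<in> ?S - {0}" "B \<in> ?S - {0}" "cl A = cl B"
    then have "A - B \<in> ?S" "F dvd A - B" by (auto simp: cl_eq intro: degree_diff_less)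
    then show "A = B" using small[of "A - B"] by auto
  qed
  ultimately have "poly_phi F = card (?S - {0})"
    unfolding poly_phi_def R_def[symmetric] by (simp add: card_image)
  also have "\<dots> = CARD('a) ^ Polynomial.degree F - 1"
    using card_poly_degree_less[where 'a = 'a, of "Polynomial.degree F"] by (simp add: card_Diff_singleton)
  finally show ?thesis .
qed

section \<open>Irreducible polynomials of large degree\<close>

text \<open>A reducible P splits into two non-units, both of positive degree and hence of smaller
  degree than P.\<close>

lemma exists_irreducible_dvd:
  fixes P :: "'a::field poly"
  assumes "Polynomial.degree P > 0"
  shows "\<exists>F. Factorial_Ring.irreducible F \<and> F dvd P"
  using assms
proof (induction "Polynomial.degree P" arbitrary: P rule: less_induct)
  case less
  show ?case
  proof (cases "Factorial_Ring.irreducible P")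
    case True
    then show ?thesis by (intro exI[of _ P]) simp
  next
    case False
    have P: "P \<noteq> 0" "\<not> is_unit P" using less.prems by (auto simp: is_unit_poly_iff)
    with False obtain A B where AB: "P = A * B" "\<not> is_unit A" "\<not> is_unit B"
      unfolding Factorial_Ring.irreducible_def by blast
    with P have "A \<noteq> 0" "B \<noteq> 0" by auto
    with AB have pos: "Polynomial.degree A > 0" "Polynomial.degree B > 0"
      by (simp_all add: is_unit_iff_degree)
    then have "Polynomial.degree A < Polynomial.degree P"
      using AB(1) \<open>A \<noteq> 0\<close> \<open>B \<noteq> 0\<close> by (simp add: degree_mult_eq)
    from less.hyps[OF this pos(1)] obtain F where "Factorial_Ring.irreducible F" "F dvd A"
      by blast
    with AB(1) show ?thesis by (blast intro: dvd_mult2)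
  qed
qed

text \<open>Euclid's argument, with the product of all nonzero polynomials of degree below
  \<open>n\<close> instead of the irreducible ones only: an irreducible divisor of Q + 1 cannot be
  among the factors of Q.\<close>

lemma exists_irreducible_degree_ge:
  "\<exists>F :: 'a::{field,finite} poly. Factorial_Ring.irreducible F \<and> Polynomial.degree F \<ge> n"
proof -
  define S where "S = {A :: 'a poly. A = 0 \<or> Polynomial.degree A < n} - {0}"
  have fin: "finite S" unfolding S_def using card_poly_degree_less by blast
  \<comment> \<open>The extra factor T makes Q + 1 nonconstant even for \<open>n \<le> 1\<close>,
    where the product over \<open>S\<close> is a constant.\<close>
  define Q where "Q = monom 1 1 * \<Prod>S"
  have "\<Prod>S \<noteq> 0" using fin by (auto simp: S_def)
  then have degQ: "Polynomial.degree Q > 0"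
    by (simp add: Q_def degree_mult_eq Polynomial.degree_monom_eq)
  then have "Polynomial.degree (Q + 1) > 0"
    by (simp add: degree_add_eq_left)
  from exists_irreducible_dvd[OF this] obtain F
    where F: "Factorial_Ring.irreducible F" "F dvd Q + 1" by blast
  have "F \<notin> S"
  proof
    assume "F \<in> S"
    then have "F dvd Q" unfolding Q_def using fin by (intro dvd_mult dvd_prodI) auto
    with F(2) have "is_unit F" using dvd_add_right_iff by blast
    with F(1) show False by (auto simp: Factorial_Ring.irreducible_def)
  qed
  moreover have "F \<noteq> 0" using F(1) by auto
  ultimately have "Polynomial.degree F \<ge> n" by (auto simp: S_def)
  with F(1) show ?thesis by blast
qed

theorem theorem1p5:
  shows "infinite {(F :: 'a::{field,finite} poly, G :: 'a poly).
           F \<noteq> 0 \<and> G \<noteq> 0 \<and> poly_phi F = poly_sigma_nm G}"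
proof
  let ?S = "{(F :: 'a poly, G :: 'a poly). F \<noteq> 0 \<and> G \<noteq> 0 \<and> poly_phi F = poly_sigma_nm G}"
  assume "finite ?S"
  \<comment> \<open>Finitely many pairs would bound the degrees of their first components.\<close>
  then have "finite ((\<lambda>(F, G). Polynomial.degree F) ` ?S)" by (rule finite_imageI)
  then obtain N where N: "\<forall>m \<in> (\<lambda>(F, G). Polynomial.degree F) ` ?S. m \<le> N"
    unfolding finite_nat_set_iff_bounded_le ..
  \<comment> \<open>Degree at least \<open>Suc N\<close> both exceeds the bound and is positive, so
    that the exponent \<open>k\<close> = deg F - 1 of the partner T^k exists.\<close>
  obtain F :: "'a poly" where F: "Factorial_Ring.irreducible F" "Polynomial.degree F \<ge> Suc N"
    using exists_irreducible_degree_ge by blast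
  from F(2) obtain k where k: "Polynomial.degree F = Suc k"
    by (metis Suc_le_D)
  have "(F, monom 1 k) \<in> ?S"
    using F(1) poly_phi_irreducible[OF F(1)] poly_sigma_nm_monom[where 'a = 'a, of k] k
    by auto
  then have "Polynomial.degree F \<in> (\<lambda>(F, G). Polynomial.degree F) ` ?S"
    by (rule image_eqI[rotated]) simp
  from bspec[OF N this] F(2) show False by simp
qed

end
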